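(* Let $(\mathcal G,\alpha,\beta)$ be such that $\sum_{x\in D}\alpha_x\le\sum_{y\in N(D)}\beta_y$ for every $D\subseteq\mathcal X$, and let $\{\mathcal M_{\bar x}(W,\xi)\}$ be an admissible family. Then for every partial allocation state $W\in\mathcal W_p$ there is a (possibly trivial) directed path in the graph $\mathcal L_p$ from $W$ to some allocation state $W'\in\mathcal W$.
   Context: **Model.** $\mathcal G=(\mathcal X,\mathcal E)$ is a finite directed graph; for $x\in\mathcal X$, $N_x=\{y:(x,y)\in\mathcal E\}$, and for $D\subseteq\mathcal X$, $N(D)=\bigcup_{x\in D}N_x$. $\alpha=(\alpha_x)$ and $\beta=(\beta_x)$ are vectors of nonnegative integers indexed by $\mathcal X$. A partial allocation state is a matrix $W\in\mathbb N^{\mathcal X\times\mathcal X}$ (nonnegative integer entries) with $W_{xy}=0$ if $(x,y)\notin\mathcal E$; $W^x:=\sum_yW_{xy}\le\alpha_x$ for all $x$; $W_y:=\sum_xW_{xy}\le\beta_y$ for all $y$. $\mathcal W_p$ is the set of partial allocation states. An allocation state is a $W\in\mathcal W_p$ with $W^x=\alpha_x$ for all $x$; $\mathcal W$ is the set of these. **Admissible families.** A functional state is $\xi\in\{0,1\}^{\mathcal X}$ ($\xi_x=1$: unit $x$ is on); $\mathbf 1$ is the all-ones state. $e_{xy}$ is the matrix with $1$ in position $(x,y)$ and $0$ elsewhere. For $W\in\mathcal W_p$, $\xi$, and $\bar x$ with $\xi_{\bar x}=1$, let $$\mathcal W_{\bar x}(W,\xi)=\{W'\in\mathcal W_p: W'\ne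 W,\ W'^{\bar x}\ge W^{\bar x},\ W'_{xy}=W_{xy}\text{ whenever }x\ne\bar x\text{ or }\xi_y=0\},$$ $$N_{\bar x}(W,\xi)=\{y\in N_{\bar x}: W_y<\beta_y,\ \xi_y=1\}.$$ A family of subsets $\mathcal M_{\bar x}(W,\xi)\subseteq\mathcal W_{\bar x}(W,\xi)$ (for all $W\in\mathcal W_p$, $\xi$, and $\bar x$ with $\xi_{\bar x}=1$) is admissible if: (i) if $W^{\bar x}<\alpha_{\bar x}$ and $y\in N_{\bar x}(W,\xi)$, then there is an integer $n\ge1$ with $W+n e_{\bar xy}\in\mathcal M_{\bar x}(W,\xi)$; (ii) if $W_{\bar xy'}>0$, $\xi_{y'}=1$, $y''\in N_{\bar x}(W,\xi)$ and $y''\neq y'$, then $W+e_{\bar xy''}-e_{\bar xy'}\in\mathcal M_{\bar x}(W,\xi)$; (iii) for all $W,W'\in\mathcal W$: $W'\in\mathcal M_{\bar x}(W,\xi)$ iff $W\in\mathcal M_{\bar x}(W',\xi)$. **Graph $\mathcal L_p$.** The directed graph with vertex set $\mathcal W_p$ and an edge $(W,W')$ iff $W'\in\mathcal M_{\bar x}(W,\mathbf 1)$ for some $\bar x\in\mathcal X$. *)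

theory Defs
  imports "Graph_Theory.Graph_Theory"
begin

text \<open>The nodes of the graph are the units. Capacities and matrices are functions on the whole
  type of units; capacities are only ever read on the node set.\<close>

definition nbrs :: "'a pair_pre_digraph \<Rightarrow> 'a \<Rightarrow> 'a set" where
  "nbrs G x = {y. (x, y) \<in> parcs G}"

definition nbrs_set :: "'a pair_pre_digraph \<Rightarrow> 'a set \<Rightarrow> 'a set" where
  "nbrs_set G D = (\<Union>x\<in>D. nbrs G x)"

type_synonym 'a matrix = "'a \<Rightarrow> 'a \<Rightarrow> nat"

definition row_sum :: "'a pair_pre_digraph \<Rightarrow> 'a matrix \<Rightarrow> 'a \<Rightarrow> nat" where
  "row_sum G W x = (\<Sum>y\<in>pverts G. W x y)"

definition col_sum :: "'a pair_pre_digraph \<Rightarrow> 'a matrix \<Rightarrow> 'a \<Rightarrow> nat" where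
  "col_sum G W y = (\<Sum>x\<in>pverts G. W x y)"

text \<open>The support condition ranges over the whole type, so that every matrix on the node set
  has exactly one representative: its extension by zero.\<close>

definition partial_allocs ::
  "'a pair_pre_digraph \<Rightarrow> ('a \<Rightarrow> nat) \<Rightarrow> ('a \<Rightarrow> nat) \<Rightarrow> 'a matrix set" where
  "partial_allocs G \<alpha> \<beta> =
    {W. (\<forall>x y. (x, y) \<notin> parcs G \<longrightarrow> W x y = 0) \<and>
        (\<forall>x\<in>pverts G. row_sum G W x \<le> \<alpha> x) \<and>
        (\<forall>y\<in>pverts G. col_sum G W y \<le> \<beta> y)}"

definition allocs ::
  "'a pair_pre_digraph \<Rightarrow> ('a \<Rightarrow> nat) \<Rightarrow> ('a \<Rightarrow> nat) \<Rightarrow> 'a matrix set" where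
  "allocs G \<alpha> \<beta> = {W \<in> partial_allocs G \<alpha> \<beta>. \<forall>x\<in>pverts G. row_sum G W x = \<alpha> x}"

definition functional_states :: "'a pair_pre_digraph \<Rightarrow> ('a \<Rightarrow> nat) set" where
  "functional_states G = (pverts G \<rightarrow>\<^sub>E {0, 1})"

definition all_on :: "'a pair_pre_digraph \<Rightarrow> 'a \<Rightarrow> nat" where
  "all_on G = (\<lambda>x\<in>pverts G. 1)"

definition unit_mat :: "'a \<Rightarrow> 'a \<Rightarrow> 'a matrix" where
  "unit_mat x y = (\<lambda>u v. if u = x \<and> v = y then 1 else 0)"

definition moves ::
  "'a pair_pre_digraph \<Rightarrow> ('a \<Rightarrow> nat) \<Rightarrow> ('a \<Rightarrow> nat) \<Rightarrow> 'a \<Rightarrow> 'a matrix \<Rightarrow> ('a \<Rightarrow> nat) \<Rightarrow> 'a matrix set"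
  where
  "moves G \<alpha> \<beta> z W \<xi> =
    {W' \<in> partial_allocs G \<alpha> \<beta>. W' \<noteq> W \<and> row_sum G W' z \<ge> row_sum G W z \<and>
      (\<forall>x\<in>pverts G. \<forall>y\<in>pverts G. x \<noteq> z \<or> \<xi> y = 0 \<longrightarrow> W' x y = W x y)}"

definition free_nbrs ::
  "'a pair_pre_digraph \<Rightarrow> ('a \<Rightarrow> nat) \<Rightarrow> 'a \<Rightarrow> 'a matrix \<Rightarrow> ('a \<Rightarrow> nat) \<Rightarrow> 'a set" where
  "free_nbrs G \<beta> z W \<xi> = {y \<in> nbrs G z. col_sum G W y < \<beta> y \<and> \<xi> y = 1}"

text \<open>A family is a total function \<open>M z W \<xi>\<close>, constrained only for partial allocation states \<open>W\<close>,
  functional states \<open>\<xi>\<close> and units \<open>z\<close> with \<open>\<xi> z = 1\<close>. In the transfer condition the subtraction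
  on naturals does not truncate, since \<open>W z y' > 0\<close>.\<close>

definition admissible ::
  "'a pair_pre_digraph \<Rightarrow> ('a \<Rightarrow> nat) \<Rightarrow> ('a \<Rightarrow> nat) \<Rightarrow>
   ('a \<Rightarrow> 'a matrix \<Rightarrow> ('a \<Rightarrow> nat) \<Rightarrow> 'a matrix set) \<Rightarrow> bool" where
  "admissible G \<alpha> \<beta> M \<longleftrightarrow>
    (\<forall>\<xi>\<in>functional_states G. \<forall>z\<in>pverts G. \<xi> z = 1 \<longrightarrow>
      (\<forall>W\<in>partial_allocs G \<alpha> \<beta>.
        M z W \<xi> \<subseteq> moves G \<alpha> \<beta> z W \<xi> \<and>
        (row_sum G W z < \<alpha> z \<longrightarrow>
          (\<forall>y\<in>free_nbrs G \<beta> z W \<xi>. \<exists>n\<ge>1. (\<lambda>u v. W u v + n * unit_mat z y u v) \<in> M z W \<xi>)) \<and>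
        (\<forall>y'\<in>pverts G. \<forall>y''\<in>free_nbrs G \<beta> z W \<xi>. W z y' > 0 \<and> \<xi> y' = 1 \<and> y'' \<noteq> y' \<longrightarrow>
          (\<lambda>u v. W u v + unit_mat z y'' u v - unit_mat z y' u v) \<in> M z W \<xi>)) \<and>
      (\<forall>W\<in>allocs G \<alpha> \<beta>. \<forall>W'\<in>allocs G \<alpha> \<beta>. W' \<in> M z W \<xi> \<longleftrightarrow> W \<in> M z W' \<xi>))"

definition alloc_graph ::
  "'a pair_pre_digraph \<Rightarrow> ('a \<Rightarrow> nat) \<Rightarrow> ('a \<Rightarrow> nat) \<Rightarrow>
   ('a \<Rightarrow> 'a matrix \<Rightarrow> ('a \<Rightarrow> nat) \<Rightarrow> 'a matrix set) \<Rightarrow> 'a matrix pair_pre_digraph" where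
  "alloc_graph G \<alpha> \<beta> M =
    \<lparr> pverts = partial_allocs G \<alpha> \<beta>,
      parcs = {(W, W'). W \<in> partial_allocs G \<alpha> \<beta> \<and> W' \<in> partial_allocs G \<alpha> \<beta> \<and>
                        (\<exists>z\<in>pverts G. W' \<in> M z W (all_on G))} \<rparr>"

end

theory Submission
  imports Defs
begin

text \<open>Suppose row \<open>x0\<close> is not exhausted. By the Hall condition an alternating walk
  \<open>x0, y0, x1, y1, \<dots>, yk\<close> (where \<open>yi\<close> is a neighbour of \<open>xi\<close> and \<open>W x(i+1) yi > 0\<close>) reaches
  a column with free capacity: otherwise the rows met by such walks violate the condition.
  Transferring a unit of the last row from \<open>y(k-1)\<close> to \<open>yk\<close> frees \<open>y(k-1)\<close>, keeps all row sums,
  and preserves the walk up to the first visit of \<open>y(k-1)\<close>. Repeating this frees a neighbour of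
  \<open>x0\<close>, after which row \<open>x0\<close> grows; so the total deficit can be driven to zero.\<close>

text \<open>Only the last column of a walk and the number of row changes before it are recorded;
  this number is the measure on which \<open>augment\<close> inducts.\<close>

inductive alt_reach :: "'a pair_pre_digraph \<Rightarrow> 'a matrix \<Rightarrow> 'a \<Rightarrow> nat \<Rightarrow> 'a \<Rightarrow> bool"
  for G W x0 where
  start: "y \<in> nbrs G x0 \<Longrightarrow> alt_reach G W x0 0 y"
| step: "alt_reach G W x0 n y' \<Longrightarrow> W x y' > 0 \<Longrightarrow> y \<in> nbrs G x \<Longrightarrow> alt_reach G W x0 (Suc n) y"

text \<open>The positive entries used by a walk of length \<open>n\<close> lie in columns reached at
  indices below \<open>n\<close>. If \<open>c\<close> is none of these, losses in column
  \<open>c\<close> cannot break the walk.\<close>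

lemma alt_reach_mono_off_column:
  assumes "alt_reach G W x0 n y"
    and "\<And>i. i < n \<Longrightarrow> \<not> alt_reach G W x0 i c"
    and "\<And>x y. y \<noteq> c \<Longrightarrow> W x y \<le> W' x y"
  shows "alt_reach G W' x0 n y"
  using assms(1,2)
proof induction
  case (start y)
  show ?case using start(1) by (rule alt_reach.start)
next
  case (step n y' x y)
  have "y' \<noteq> c" using step.hyps(1) step.prems by blast
  then have "W' x y' > 0" using assms(3)[of y' x] step.hyps(2) by simp
  then show ?case using step by (meson alt_reach.step less_SucI)
qed

lemma alt_reach_free:
  assumes fin: "pair_fin_digraph G"
    and hall: "\<And>D. D \<subseteq> pverts G \<Longrightarrow> (\<Sum>x\<in>D. \<alpha> x) \<le> (\<Sum>y\<in>nbrs_set G D. \<beta> y)"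
    and W: "W \<in> partial_allocs G \<alpha> \<beta>"
    and x0: "x0 \<in> pverts G" "row_sum G W x0 < \<alpha> x0"
  shows "\<exists>n y. alt_reach G W x0 n y \<and> col_sum G W y < \<beta> y"
proof (rule ccontr)
  interpret pair_fin_digraph G by (fact fin)
  assume "\<not> ?thesis"
  then have full: "\<beta> y \<le> col_sum G W y" if "alt_reach G W x0 n y" for n y
    using that by (meson not_le)
  \<comment> \<open>\<open>x0\<close> is added by hand: walks start there whether or not its row has
    a positive entry in a reached column.\<close>
  define D where "D = insert x0 {x \<in> pverts G. \<exists>n y. alt_reach G W x0 n y \<and> W x y > 0}"
  have D: "D \<subseteq> pverts G" using x0 by (auto simp: D_def)
  have finD: "finite D" using D by (rule finite_subset) simp
  have N: "nbrs_set G D \<subseteq> pverts G"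
    by (auto simp: nbrs_set_def nbrs_def dest: in_arcsD2)
  have reach: "\<exists>n. alt_reach G W x0 n y" if "y \<in> nbrs_set G D" for y
    using that unfolding nbrs_set_def D_def by (auto intro: alt_reach.intros)
  \<comment> \<open>Every column of N(D) is reached, so a positive entry in it would put its row
    into \<open>D\<close>. The full columns of N(D) are thus filled by rows of \<open>D\<close>
    alone.\<close>
  have supp: "W x y = 0" if "y \<in> nbrs_set G D" "x \<in> pverts G - D" for x y
    using that(2) reach[OF that(1)] by (auto simp: D_def)
  have "(\<Sum>x\<in>D. \<alpha> x) \<le> (\<Sum>y\<in>nbrs_set G D. \<beta> y)" by (rule hall[OF D])
  also have "\<dots> \<le> (\<Sum>y\<in>nbrs_set G D. col_sum G W y)"
    by (rule sum_mono) (use reach full in blast)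
  also have "\<dots> = (\<Sum>y\<in>nbrs_set G D. \<Sum>x\<in>D. W x y)"
    unfolding col_sum_def using D supp
    by (intro sum.cong refl sum.mono_neutral_right) auto
  also have "\<dots> = (\<Sum>x\<in>D. \<Sum>y\<in>nbrs_set G D. W x y)" by (rule sum.swap)
  also have "\<dots> \<le> (\<Sum>x\<in>D. row_sum G W x)"
    unfolding row_sum_def using N by (intro sum_mono sum_mono2) auto
  \<comment> \<open>Strict because \<open>x0\<close> lies in \<open>D\<close> and has a
    deficit.\<close>
  also have "\<dots> < (\<Sum>x\<in>D. \<alpha> x)"
    using W D x0 finD by (intro sum_strict_mono_ex1) (auto simp: partial_allocs_def D_def)
  finally show False by simp
qed

lemma all_on_functional: "all_on G \<in> functional_states G"
  by (auto simp: all_on_def functional_states_def)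

lemma alloc_graph_wf: "wf_digraph (with_proj (alloc_graph G \<alpha> \<beta> M))"
  by unfold_locales (auto simp: alloc_graph_def)

context
  fixes G :: "'a pair_pre_digraph" and \<alpha> \<beta> :: "'a \<Rightarrow> nat"
    and M :: "'a \<Rightarrow> 'a matrix \<Rightarrow> ('a \<Rightarrow> nat) \<Rightarrow> 'a matrix set"
  assumes fin: "pair_fin_digraph G"
    and adm: "admissible G \<alpha> \<beta> M"
begin

interpretation pair_fin_digraph G by (fact fin)

interpretation L: wf_digraph "with_proj (alloc_graph G \<alpha> \<beta> M)"
  by (rule alloc_graph_wf)

abbreviation alloc_reachable :: "'a matrix \<Rightarrow> 'a matrix \<Rightarrow> bool" (infix "\<leadsto>" 50) where
  "W \<leadsto> W' \<equiv> reachable (with_proj (alloc_graph G \<alpha> \<beta> M)) W W'"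

text \<open>Arcs of \<open>alloc_graph\<close> use only the all-on state, where the conditions on
  \<xi> hold at every node.\<close>

lemma admissible_all_on:
  assumes "z \<in> pverts G" "W \<in> partial_allocs G \<alpha> \<beta>"
  shows "M z W (all_on G) \<subseteq> partial_allocs G \<alpha> \<beta>"
    and "row_sum G W z < \<alpha> z \<Longrightarrow> y \<in> free_nbrs G \<beta> z W (all_on G) \<Longrightarrow>
      \<exists>n\<ge>1. (\<lambda>u v. W u v + n * unit_mat z y u v) \<in> M z W (all_on G)"
    and "y' \<in> pverts G \<Longrightarrow> y \<in> free_nbrs G \<beta> z W (all_on G) \<Longrightarrow> W z y' > 0 \<Longrightarrow> y \<noteq> y' \<Longrightarrow>
      (\<lambda>u v. W u v + unit_mat z y u v - unit_mat z y' u v) \<in> M z W (all_on G)"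
proof -
  have 1: "all_on G v = 1" if "v \<in> pverts G" for v using that by (simp add: all_on_def)
  note adm' = adm[unfolded admissible_def, rule_format, OF all_on_functional assms(1) 1[OF assms(1)],
    THEN conjunct1, rule_format, OF assms(2)]
  show "M z W (all_on G) \<subseteq> partial_allocs G \<alpha> \<beta>"
    using adm' by (auto simp: moves_def)
  show "row_sum G W z < \<alpha> z \<Longrightarrow> y \<in> free_nbrs G \<beta> z W (all_on G) \<Longrightarrow>
      \<exists>n\<ge>1. (\<lambda>u v. W u v + n * unit_mat z y u v) \<in> M z W (all_on G)"
    using adm' by blast
  show "y' \<in> pverts G \<Longrightarrow> y \<in> free_nbrs G \<beta> z W (all_on G) \<Longrightarrow> W z y' > 0 \<Longrightarrow> y \<noteq> y' \<Longrightarrow>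
      (\<lambda>u v. W u v + unit_mat z y u v - unit_mat z y' u v) \<in> M z W (all_on G)"
    using adm' 1 by blast
qed

lemma step_reachable:
  assumes "z \<in> pverts G" "W \<in> partial_allocs G \<alpha> \<beta>" "W' \<in> M z W (all_on G)"
  shows "W' \<in> partial_allocs G \<alpha> \<beta>" "W \<leadsto> W'"
proof -
  show W': "W' \<in> partial_allocs G \<alpha> \<beta>" using admissible_all_on(1) assms by blast
  have "(W, W') \<in> arcs_ends (with_proj (alloc_graph G \<alpha> \<beta> M))"
    using assms W' by (auto simp: arcs_ends_def arc_to_ends_def alloc_graph_def)
  then show "W \<leadsto> W'" by (rule L.reachable_adjI)
qed

text \<open>Admissibility provides some increment \<open>n\<close> of at least 1 without fixing it,
  so only strict growth of row \<open>z\<close> is claimed. Capacities are respected because members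
  of the family are partial allocation states.\<close>

lemma fill_step:
  assumes z: "z \<in> pverts G" and W: "W \<in> partial_allocs G \<alpha> \<beta>"
    and lt: "row_sum G W z < \<alpha> z" and y: "y \<in> nbrs G z" "col_sum G W y < \<beta> y"
  shows "\<exists>W'\<in>partial_allocs G \<alpha> \<beta>. W \<leadsto> W' \<and> row_sum G W z < row_sum G W' z \<and>
    (\<forall>x. row_sum G W x \<le> row_sum G W' x)"
proof -
  have yV: "y \<in> pverts G" using y by (auto simp: nbrs_def dest: in_arcsD2)
  have "y \<in> free_nbrs G \<beta> z W (all_on G)"
    using y yV by (simp add: free_nbrs_def all_on_def)
  then obtain n where n: "n \<ge> 1" "(\<lambda>u v. W u v + n * unit_mat z y u v) \<in> M z W (all_on G)"
    (is "?W \<in> _") using admissible_all_on(2)[OF z W lt] by blast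
  have rows: "row_sum G ?W x = row_sum G W x + (if x = z then n else 0)" for x
    using yV by (simp add: row_sum_def unit_mat_def sum.distrib flip: sum_distrib_left)
  show ?thesis
    using step_reachable[OF z W n(2)] n(1) by (intro bexI[of _ ?W]) (auto simp: rows)
qed

text \<open>The three facts recorded are those that \<open>augment\<close> needs: deficits persist,
  \<open>y'\<close> loses load, and no other column loses an entry.\<close>

lemma transfer_step:
  assumes z: "z \<in> pverts G" and W: "W \<in> partial_allocs G \<alpha> \<beta>"
    and y: "y \<in> nbrs G z" "col_sum G W y < \<beta> y" and y': "W z y' > 0" "y \<noteq> y'"
  shows "\<exists>W'\<in>partial_allocs G \<alpha> \<beta>. W \<leadsto> W' \<and> (\<forall>x. row_sum G W' x = row_sum G W x) \<and>
    col_sum G W' y' < col_sum G W y' \<and> (\<forall>u v. v \<noteq> y' \<longrightarrow> W u v \<le> W' u v)"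
proof -
  let ?W = "\<lambda>u v. W u v + unit_mat z y u v - unit_mat z y' u v"
  have yV: "y \<in> pverts G" using y by (auto simp: nbrs_def dest: in_arcsD2)
  have "(z, y') \<in> parcs G" using W y' by (fastforce simp: partial_allocs_def)
  then have y'V: "y' \<in> pverts G" by (auto dest: in_arcsD2)
  have "y \<in> free_nbrs G \<beta> z W (all_on G)"
    using y yV by (simp add: free_nbrs_def all_on_def)
  then have mem: "?W \<in> M z W (all_on G)" using admissible_all_on(3)[OF z W y'V] y' by blast
  \<comment> \<open>Moving the subtracted unit to the other side avoids truncated subtraction when
    summing; it is valid since \<open>W z y' > 0\<close>.\<close>
  have balance: "?W u v + unit_mat z y' u v = W u v + unit_mat z y u v" for u v
    using y' by (auto simp: unit_mat_def)
  have unit: "(\<Sum>v\<in>pverts G. unit_mat z w x v) = (if x = z then 1 else 0)"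
    if "w \<in> pverts G" for w x using that by (simp add: unit_mat_def)
  have "row_sum G ?W x + (\<Sum>v\<in>pverts G. unit_mat z y' x v) =
      row_sum G W x + (\<Sum>v\<in>pverts G. unit_mat z y x v)" for x
    unfolding row_sum_def sum.distrib[symmetric] balance ..
  then have rows: "row_sum G ?W x = row_sum G W x" for x
    unfolding unit[OF yV] unit[OF y'V] by simp
  have "col_sum G ?W y' + (\<Sum>u\<in>pverts G. unit_mat z y' u y') =
      col_sum G W y' + (\<Sum>u\<in>pverts G. unit_mat z y u y')"
    unfolding col_sum_def sum.distrib[symmetric] balance ..
  then have col: "col_sum G ?W y' < col_sum G W y'"
    using z y' by (simp add: unit_mat_def)
  show ?thesis
    using step_reachable[OF z W mem] rows col
    by (intro bexI[of _ ?W]) (auto simp: unit_mat_def)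
qed

text \<open>Strong induction on the walk length, with \<open>W\<close> arbitrary because each
  transfer changes the state. Length 0 means that \<open>x0\<close> itself has a free
  neighbour.\<close>

lemma augment:
  assumes "alt_reach G W x0 n y" "col_sum G W y < \<beta> y"
    and "W \<in> partial_allocs G \<alpha> \<beta>" and "x0 \<in> pverts G" "row_sum G W x0 < \<alpha> x0"
  shows "\<exists>W'\<in>partial_allocs G \<alpha> \<beta>. W \<leadsto> W' \<and> row_sum G W x0 < row_sum G W' x0 \<and>
    (\<forall>x. row_sum G W x \<le> row_sum G W' x)"
  using assms
proof (induction n arbitrary: W y rule: less_induct)
  case (less n)
  note W = \<open>W \<in> partial_allocs G \<alpha> \<beta>\<close>
  from less.prems(1) show ?case
  proof cases
    case start
    then show ?thesis using fill_step less.prems by blast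
  next
    case (step m y' x)
    show ?thesis
    proof (cases "col_sum G W y' < \<beta> y'")
      case True
      \<comment> \<open>The walk cut at \<open>y'\<close> already ends in a free column.\<close>
      then show ?thesis using less.IH[of m W y'] step less.prems by blast
    next
      case False
      then have "y \<noteq> y'" using less.prems(2) by auto
      have "(x, y) \<in> parcs G" using step by (simp add: nbrs_def)
      then have "x \<in> pverts G" by (auto dest: in_arcsD1)
      \<comment> \<open>With this bound, the strict drop caused by the transfer makes
        \<open>y'\<close> a free column.\<close>
      have le: "col_sum G W y' \<le> \<beta> y'"
      proof -
        have "(x, y') \<in> parcs G" using W step by (fastforce simp: partial_allocs_def)
        then show ?thesis using W by (auto simp: partial_allocs_def dest: in_arcsD2)
      qed
      obtain V where V: "V \<in> partial_allocs G \<alpha> \<beta>" "W \<leadsto> V"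
        "\<And>x. row_sum G V x = row_sum G W x" "col_sum G V y' < col_sum G W y'"
        "\<And>u v. v \<noteq> y' \<Longrightarrow> W u v \<le> V u v"
        using transfer_step[OF \<open>x \<in> pverts G\<close> W step(4) less.prems(2) step(3) \<open>y \<noteq> y'\<close>] by blast
      \<comment> \<open>The original walk to \<open>y'\<close> may pass through \<open>y'\<close>
        earlier and use an entry that the transfer destroys. A shortest one cannot, so it survives
        in \<open>V\<close>, and its length is still below \<open>n\<close>.\<close>
      define k where "k = (LEAST k. alt_reach G W x0 k y')"
      have "k \<le> m" unfolding k_def by (rule Least_le) (rule step(2))
      have "alt_reach G W x0 k y'" unfolding k_def by (rule LeastI) (rule step(2))
      then have "alt_reach G V x0 k y'"
        by (rule alt_reach_mono_off_column) (use V(5) not_less_Least k_def in blast)+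
      then obtain W' where "W' \<in> partial_allocs G \<alpha> \<beta>" "V \<leadsto> W'"
        "row_sum G V x0 < row_sum G W' x0" "\<forall>x. row_sum G V x \<le> row_sum G W' x"
        using less.IH[of k V y'] \<open>k \<le> m\<close> step(1) V le less.prems by auto
      then show ?thesis using V(2,3) by (auto intro: L.reachable_trans)
    qed
  qed
qed

text \<open>Induction on the total deficit. No difference truncates, since row sums of partial
  allocation states are at most \<alpha>.\<close>

lemma alloc_reachable_from_partial:
  assumes hall: "\<And>D. D \<subseteq> pverts G \<Longrightarrow> (\<Sum>x\<in>D. \<alpha> x) \<le> (\<Sum>y\<in>nbrs_set G D. \<beta> y)"
    and "W \<in> partial_allocs G \<alpha> \<beta>"
  shows "\<exists>W'\<in>allocs G \<alpha> \<beta>. W \<leadsto> W'"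
  using assms(2)
proof (induction "\<Sum>x\<in>pverts G. \<alpha> x - row_sum G W x" arbitrary: W rule: less_induct)
  case less
  show ?case
  proof (cases "W \<in> allocs G \<alpha> \<beta>")
    case True
    have "W \<leadsto> W" by (rule L.reachable_refl) (simp add: alloc_graph_def less.prems)
    with True show ?thesis by blast
  next
    case False
    then obtain x0 where x0: "x0 \<in> pverts G" "row_sum G W x0 < \<alpha> x0"
      using less.prems unfolding allocs_def partial_allocs_def by (auto simp: le_less)
    obtain n y where "alt_reach G W x0 n y" "col_sum G W y < \<beta> y"
      using alt_reach_free[OF fin hall less.prems x0] by blast
    from augment[OF this less.prems x0] obtain V where V: "V \<in> partial_allocs G \<alpha> \<beta>" "W \<leadsto> V"
      "row_sum G W x0 < row_sum G V x0" "\<And>x. row_sum G W x \<le> row_sum G V x" by blast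
    \<comment> \<open>No row loses load and row \<open>x0\<close> strictly gains.\<close>
    have "(\<Sum>x\<in>pverts G. \<alpha> x - row_sum G V x) < (\<Sum>x\<in>pverts G. \<alpha> x - row_sum G W x)"
      using V x0 by (intro sum_strict_mono_ex1) (auto intro: diff_le_mono2 diff_less_mono2)
    from less.hyps[OF this V(1)] show ?thesis using V(2) L.reachable_trans by blast
  qed
qed

end

theorem theorem6:
  fixes G :: "'a pair_pre_digraph" and \<alpha> \<beta> :: "'a \<Rightarrow> nat"
    and M :: "'a \<Rightarrow> 'a matrix \<Rightarrow> ('a \<Rightarrow> nat) \<Rightarrow> 'a matrix set"
    and W :: "'a matrix"
  assumes "pair_fin_digraph G"
    and "\<And>D. D \<subseteq> pverts G \<Longrightarrow> (\<Sum>x\<in>D. \<alpha> x) \<le> (\<Sum>y\<in>nbrs_set G D. \<beta> y)"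
    and "admissible G \<alpha> \<beta> M"
    and "W \<in> partial_allocs G \<alpha> \<beta>"
  shows "\<exists>W'\<in>allocs G \<alpha> \<beta>. \<exists>p. pre_digraph.apath (with_proj (alloc_graph G \<alpha> \<beta> M)) W p W'"
  \<comment> \<open>In a well-formed digraph, reachability is the existence of a path without
    repeated vertices.\<close>
  using alloc_reachable_from_partial[OF assms(1,3,2,4)]
  by (simp add: wf_digraph.reachable_apath[OF alloc_graph_wf])

end
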